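(* Let $n\ge1$. The map assigning to each $\pi\in\mathcal{S}_n$ its filled shape (the diagram $\Lambda(\pi)$ together with the set of its dotted cells) is injective: if $\pi,\sigma\in\mathcal{S}_n$ have the same shape $\Lambda(\pi)=\Lambda(\sigma)$ and the same set of dotted cells, then $\pi=\sigma$.
   Context: $\mathcal{S}_n$ is the set of permutations $\pi=\pi_1\cdots\pi_n$ of $[n]=\{1,\ldots,n\}$, written as words. The standardization $w^{\ast}$ of a word $w$ of $m$ distinct positive integers is the permutation in $\mathcal{S}_m$ obtained by replacing the $i$th smallest letter by $i$. The map $D$ from permutations in $\mathcal{S}_n$ to Dyck words of length $2n$ in the letters $\mathsf{u}$ (up step $(0,1)$) and $\mathsf{r}$ (right step $(1,0)$) is defined recursively by $D(\emptyset)=\emptyset$ and, for $\pi=\pi_L\,n\,\pi_R\in\mathcal{S}_n$ with $n\ge1$ ($\pi_L,\pi_R$ the possibly empty words to the left and right of the letter $n$), $D(\pi)=\mathsf{u}\,D(\pi_L^{\ast})\,\mathsf{r}\,D(\pi_R^{\ast})$. $\Lambda(\pi)$ is the partition with exactly $n-1$ parts (parts equal to $0$ allowed) whose Young diagram (left-justified, longest row on top) is the region above the path $D(\pi)$ drawn from $(0,0)$ to $(n,n)$. Equivalently, the parts of $\Lambda(\pi)$ are, in weakly decreasing order, the numbers of letters $\mathsf{r}$ preceding the 2nd, 3rd, ..., $n$th letter $\mathsf{u}$ in $D(\pi)$. The left border number $a_j$ of $\pi$ is the largest position $m<j$ with $\pi_m>\pi_j$, or $0$ if no such position exists; the parts of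 $\Lambda(\pi)$ are the numbers $a_2,\ldots,a_n$ sorted in weakly decreasing order. Filled shape of $\pi$: label the columns of $\Lambda(\pi)$ from left to right by $1,2,\ldots,k$, where $k$ is the last descent of $\pi$ (the largest $i$ with $\pi_i>\pi_{i+1}$). For each $i\ge1$, label the rows of length $i$ from bottom to top with the numbers $j$, in increasing order, for which $a_j=i$. Put a dot into the cell in the column labeled $i$ and the row labeled $j$ whenever $(i,j)$ is an inversion of $\pi$, i.e. $i<j$ and $\pi_i>\pi_j$. *)

theory Defs
  imports "HOL-Combinatorics.Multiset_Permutations"
begin

text \<open>
  Permutations are words, i.e. lists over \<open>{1..n}\<close>. Positions are 1-based as in the usual
  notation $\pi = \pi_1 \cdots \pi_n$, while list indexing is 0-based.
\<close>

abbreviation perms :: "nat \<Rightarrow> nat list set" where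
  "perms n \<equiv> permutations_of_set {1..n}"

definition letter :: "nat list \<Rightarrow> nat \<Rightarrow> nat" where
  "letter w i = w ! (i - 1)"

definition standardize :: "nat list \<Rightarrow> nat list" where
  "standardize w = map (\<lambda>x. card {y \<in> set w. y \<le> x}) w"

lemma length_standardize [simp]: "length (standardize w) = length w"
  by (simp add: standardize_def)

datatype step = U | R

text \<open>
  The word is split at its largest letter, which is the letter \<open>n\<close> if the word is in
  \<open>perms n\<close>; see \<open>dyck_path_split\<close> below.
\<close>

function dyck_path :: "nat list \<Rightarrow> step list" where
  "dyck_path w =
     (if w = [] then []
      else let m = Max (set w);
               wL = takeWhile (\<lambda>x. x \<noteq> m) w;
               wR = tl (dropWhile (\<lambda>x. x \<noteq> m) w)
           in U # dyck_path (standardize wL) @ R # dyck_path (standardize wR))"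
  by pat_completeness auto
termination
proof (relation "measure length", goal_cases)
  case (2 w m wL)
  then have "m \<in> set w" by simp
  then have "dropWhile (\<lambda>x. x \<noteq> m) w \<noteq> []"
    by (auto simp: dropWhile_eq_Nil_conv)
  moreover have "w = wL @ dropWhile (\<lambda>x. x \<noteq> m) w"
    using 2 by simp
  ultimately have "length wL < length w"
    by (metis length_append length_greater_0_conv less_add_same_cancel1)
  then show ?case by simp
next
  case (3 w m wL wR)
  have "length (dropWhile (\<lambda>x. x \<noteq> m) w) \<le> length w"
    by (rule length_dropWhile_le)
  moreover have "length w > 0" using 3 by simp
  ultimately have "length wR < length w"
    using 3 by (simp only: length_tl)
  then show ?case by simp
qed simp

declare dyck_path.simps [simp del]

lemma dyck_path_Nil: "dyck_path [] = []"
  by (simp add: dyck_path.simps)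

lemma dyck_path_split:
  assumes "wL @ n # wR \<in> perms n"
  shows "dyck_path (wL @ n # wR) =
           U # dyck_path (standardize wL) @ R # dyck_path (standardize wR)"
proof -
  let ?w = "wL @ n # wR"
  have s: "set ?w = {1..n}" and d: "distinct ?w"
    using assms by (simp_all only: permutations_of_set_def mem_Collect_eq)
  have "n \<in> {1..n}" unfolding s[symmetric] by simp
  then have M: "Max (set ?w) = n"
    unfolding s by (intro Max_eqI) auto
  have nL: "\<And>x. x \<in> set wL \<Longrightarrow> x \<noteq> n" using d by auto
  have t: "takeWhile (\<lambda>x. x \<noteq> n) ?w = wL" "dropWhile (\<lambda>x. x \<noteq> n) ?w = n # wR"
    using nL by (simp_all add: takeWhile_append2 dropWhile_append2)
  show ?thesis
    by (subst dyck_path.simps) (simp only: M t Let_def list.sel append_is_Nil_conv, simp)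
qed

text \<open>
  The region above the path consists of one row for each up step, namely the cells to the left
  of that step; its length is the number of right steps before it. The row of the first up step
  is empty and dropped. The last up step gives the topmost (longest) row, so the parts are
  listed from top to bottom.
\<close>

definition Lambda :: "nat list \<Rightarrow> nat list" where
  "Lambda w =
     (let p = dyck_path w;
          ups = filter (\<lambda>k. p ! k = U) [0..<length p]
      in rev (tl (map (\<lambda>k. count_list (take k p) R) ups)))"

definition left_border :: "nat list \<Rightarrow> nat \<Rightarrow> nat" where
  "left_border w j = Max (insert 0 {m. 1 \<le> m \<and> m < j \<and> letter w m > letter w j})"

definition inversion :: "nat list \<Rightarrow> nat \<Rightarrow> nat \<Rightarrow> bool" where
  "inversion w i j \<longleftrightarrow>
     1 \<le> i \<and> i < j \<and> j \<le> length w \<and> letter w i > letter w j"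

text \<open>
  A cell \<open>(r, c)\<close> is given by its row \<open>r\<close>, counted from the top, and its column \<open>c\<close>, counted
  from the left, both starting from 1.
\<close>

definition cells :: "nat list \<Rightarrow> (nat \<times> nat) set" where
  "cells l = {(r, c). 1 \<le> r \<and> r \<le> length l \<and> 1 \<le> c \<and> c \<le> l ! (r - 1)}"

text \<open>
  The index into the sorted list is the number of rows below row \<open>r\<close> that have the same length:
  rows of equal length get their labels from bottom to top in increasing order. Only rows of
  positive length are labelled; the value for an empty row is irrelevant.
\<close>

definition row_label :: "nat list \<Rightarrow> nat \<Rightarrow> nat" where
  "row_label w r =
     (let l = Lambda w; i = l ! (r - 1)
      in sorted_list_of_set {j \<in> {1..length w}. left_border w j = i}
           ! card {r'. r < r' \<and> r' \<le> length l \<and> l ! (r' - 1) = i})"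

text \<open>
  Column \<open>c\<close> has label \<open>c\<close>. The range of column labels needs no separate mention, since the number
  of columns of \<open>Lambda w\<close> is the last descent of \<open>w\<close>.
\<close>

definition dotted_cells :: "nat list \<Rightarrow> (nat \<times> nat) set" where
  "dotted_cells w = {(r, c) \<in> cells (Lambda w). inversion w c (row_label w r)}"

definition filled_shape :: "nat list \<Rightarrow> nat list \<times> (nat \<times> nat) set" where
  "filled_shape w = (Lambda w, dotted_cells w)"

end

theory Submission
  imports Defs
begin

text \<open>
  The parts of \<open>Lambda w\<close> are the left border numbers \<open>a\<^sub>2, \<dots>, a\<^sub>n\<close>. Their multiset determines the
  sequence, because \<open>a\<^sub>j\<close> is the largest value below \<open>j\<close> among \<open>a\<^sub>j, \<dots>, a\<^sub>n\<close>: if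
  \<open>a\<^sub>j < a\<^sub>m < j < m\<close>, then the letter at position \<open>a\<^sub>m\<close> exceeds the one at \<open>m\<close>, which exceeds the one
  at \<open>j\<close>, contradicting the maximality of \<open>a\<^sub>j\<close>. So permutations of equal shape have the same
  row labels. Since every inversion \<open>(i, j)\<close> satisfies \<open>i \<le> a\<^sub>j\<close>, the dots show all inversions, and
  these determine the permutation.
\<close>

section \<open>Left border numbers\<close>

lemma left_border_cong:
  assumes "\<And>m. 1 \<le> m \<Longrightarrow> m < j \<Longrightarrow> letter v m > letter v j \<longleftrightarrow> letter w m > letter w j"
  shows "left_border v j = left_border w j"
proof -
  have "{m. 1 \<le> m \<and> m < j \<and> letter v m > letter v j} = {m. 1 \<le> m \<and> m < j \<and> letter w m > letter w j}"
    using assms by auto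
  then show ?thesis by (simp only: left_border_def)
qed

lemma left_border_ge:
  assumes "1 \<le> m" "m < j" "letter w m > letter w j"
  shows "m \<le> left_border w j"
  unfolding left_border_def using assms by (intro Max_ge) auto

lemma left_border_cases:
  "left_border w j = 0 \<or>
    1 \<le> left_border w j \<and> left_border w j < j \<and> letter w (left_border w j) > letter w j"
proof -
  have "left_border w j \<in> insert 0 {m. 1 \<le> m \<and> m < j \<and> letter w m > letter w j}"
    unfolding left_border_def by (rule Max_in) auto
  then show ?thesis by auto
qed

lemma left_border_less: "1 \<le> j \<Longrightarrow> left_border w j < j"
  using left_border_cases[of w j] by auto

lemma left_border_eqI:
  assumes "1 \<le> m" "m < j" "letter w m > letter w j"
    and "\<And>k. m < k \<Longrightarrow> k < j \<Longrightarrow> letter w k \<le> letter w j"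
  shows "left_border w j = m"
proof (rule antisym)
  show "m \<le> left_border w j" by (rule left_border_ge) (use assms in auto)
  show "left_border w j \<le> m"
    using left_border_cases[of w j] assms(4)[of "left_border w j"] by force
qed

lemma left_border_eq_0:
  assumes "\<And>k. 1 \<le> k \<Longrightarrow> k < j \<Longrightarrow> letter w k \<le> letter w j"
  shows "left_border w j = 0"
  using left_border_cases[of w j] assms[of "left_border w j"] by force

text \<open>For \<open>j < m\<close>, a letter at \<open>j\<close> larger than the one at
  \<open>m\<close> would push the border of \<open>m\<close> up to at least \<open>j\<close>. So the
  letter at \<open>left_border w m\<close>, if this is positive, exceeds the letter at
  \<open>m\<close> and with it the one at \<open>j\<close>, and it competes for the border of
  \<open>j\<close>.\<close>

lemma left_border_later:
  assumes "1 \<le> j" "j \<le> m" "left_border w m < j"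
  shows "left_border w m \<le> left_border w j"
proof (cases "left_border w m = 0 \<or> m = j")
  case False
  have m: "1 \<le> left_border w m" "letter w (left_border w m) > letter w m"
    using left_border_cases[of w m] False by auto
  have "letter w j \<le> letter w m"
    using left_border_ge[of j m w] assms False by force
  then show ?thesis
    using m assms by (intro left_border_ge[OF m(1)]) auto
qed auto

text \<open>The list also contains the border number 0 of the first position, which has no row in
  \<open>Lambda w\<close>; index \<open>k\<close> belongs to position \<open>k + 1\<close>.\<close>

definition left_borders :: "nat list \<Rightarrow> nat list" where
  "left_borders w = map (left_border w) [1..<Suc (length w)]"

lemma length_left_borders [simp]: "length (left_borders w) = length w"
  by (simp add: left_borders_def del: upt_Suc)

lemma nth_left_borders: "k < length w \<Longrightarrow> left_borders w ! k = left_border w (Suc k)"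
  unfolding left_borders_def by (simp del: upt_Suc)

lemma count_left_borders:
  "count (mset (left_borders w)) i = card {j \<in> {1..length w}. left_border w j = i}"
proof -
  have "count (mset (left_borders w)) i = length (filter (\<lambda>j. i = left_border w j) [1..<Suc (length w)])"
    unfolding left_borders_def count_mset count_list_eq_length_filter filter_map o_def by simp
  also have "\<dots> = card (set (filter (\<lambda>j. i = left_border w j) [1..<Suc (length w)]))"
    by (rule distinct_card[symmetric]) simp
  also have "set (filter (\<lambda>j. i = left_border w j) [1..<Suc (length w)])
      = {j \<in> {1..length w}. left_border w j = i}"
    by auto
  finally show ?thesis .
qed

text \<open>The prefixes agree by induction on their length: cancelling a common prefix leaves
  suffixes with the same values, and the next entry can be read off from that set of values.\<close>

lemma left_borders_eqI:
  assumes "mset (left_borders v) = mset (left_borders w)"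
  shows "left_borders v = left_borders w"
proof -
  have len: "length v = length w"
    using mset_eq_length[OF assms] by simp
  have "take k (left_borders v) = take k (left_borders w)" if "k \<le> length w" for k
    using that
  proof (induction k)
    case (Suc k)
    then have k: "k < length w" and IH: "take k (left_borders v) = take k (left_borders w)" by auto
    have "mset (take k (left_borders v)) + mset (drop k (left_borders v))
        = mset (take k (left_borders w)) + mset (drop k (left_borders w))"
      by (simp only: assms mset_append[symmetric] append_take_drop_id)
    then have "set (drop k (left_borders v)) = set (drop k (left_borders w))"
      using IH by (metis add_left_imp_eq set_mset_mset)
    \<comment> \<open>Index \<open>k\<close> stands for position \<open>k + 1\<close>, so values
      below the position are those at most \<open>k\<close>. The entry itself is one of them, and
      \<open>left_border_later\<close> bounds the others by it.\<close>
    moreover have "left_border x (Suc k) = Max {i \<in> set (drop k (left_borders x)). i \<le> k}"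
      if "length x = length w" for x
    proof (rule Max_eqI[symmetric])
      have "left_borders x ! k \<in> set (drop k (left_borders x))"
        using k that by (simp add: Cons_nth_drop_Suc[symmetric])
      then show "left_border x (Suc k) \<in> {i \<in> set (drop k (left_borders x)). i \<le> k}"
        using k that left_border_less[of "Suc k" x] by (simp add: nth_left_borders)
    next
      fix i assume i: "i \<in> {i \<in> set (drop k (left_borders x)). i \<le> k}"
      then obtain m where "m < length x - k" "i = left_borders x ! (k + m)"
        by (auto simp: in_set_conv_nth)
      then have "i = left_border x (Suc (k + m))"
        by (simp add: nth_left_borders)
      then show "i \<le> left_border x (Suc k)"
        using i left_border_later[of "Suc k" "Suc (k + m)" x] by auto
    qed simp
    ultimately have "left_borders v ! k = left_borders w ! k"
      using k len by (simp add: nth_left_borders)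
    then show ?case using IH k len by (simp add: take_Suc_conv_app_nth)
  qed simp
  from this[of "length w"] show ?thesis by (simp add: len)
qed

section \<open>The parts of the shape\<close>

text \<open>Recursive form of the list of counts inside \<open>Lambda\<close>: a leading
  \<open>R\<close> raises every later count by one. Concatenating paths then becomes a shift of the
  second list.\<close>

fun right_counts :: "step list \<Rightarrow> nat list" where
  "right_counts [] = []"
| "right_counts (U # p) = 0 # right_counts p"
| "right_counts (R # p) = map Suc (right_counts p)"

lemma right_counts_append:
  "right_counts (p @ q) = right_counts p @ map ((+) (count_list p R)) (right_counts q)"
  by (induction p rule: right_counts.induct) (auto simp: id_def)

lemma right_counts_eq:
  "map (\<lambda>k. count_list (take k p) R) (filter (\<lambda>k. p ! k = U) [0..<length p]) = right_counts p"
proof (induction p)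
  case (Cons s p)
  have *: "[0..<length (s # p)] = 0 # map Suc [0..<length p]"
    by (simp add: upt_conv_Cons map_Suc_upt del: upt_Suc)
  show ?case
    unfolding * by (cases s) (simp_all add: filter_map o_def Cons.IH[symmetric])
qed simp

lemma Lambda_eq: "Lambda w = rev (tl (right_counts (dyck_path w)))"
  by (simp add: Lambda_def Let_def right_counts_eq)

section \<open>Standardization and the split at the largest letter\<close>

lemma standardize_less:
  fixes w :: "nat list"
  assumes "x \<in> set w" "y \<in> set w"
  shows "card {z \<in> set w. z \<le> x} < card {z \<in> set w. z \<le> y} \<longleftrightarrow> x < y"
proof -
  have *: "card {z \<in> set w. z \<le> a} < card {z \<in> set w. z \<le> b}" if "a < b" "b \<in> set w" for a b
  proof (rule psubset_card_mono)
    have "b \<in> {z \<in> set w. z \<le> b} - {z \<in> set w. z \<le> a}" using that by simp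
    moreover have "{z \<in> set w. z \<le> a} \<subseteq> {z \<in> set w. z \<le> b}" using that by auto
    ultimately show "{z \<in> set w. z \<le> a} \<subset> {z \<in> set w. z \<le> b}" by blast
  qed simp
  show ?thesis
    using *[of x y] *[of y x] assms by (cases x y rule: linorder_cases) auto
qed

lemma distinct_standardize: "distinct w \<Longrightarrow> distinct (standardize w)"
  unfolding standardize_def distinct_map
proof (intro conjI inj_onI)
  fix x y assume "x \<in> set w" "y \<in> set w" "card {z \<in> set w. z \<le> x} = card {z \<in> set w. z \<le> y}"
  then show "x = y"
    using standardize_less[of x w y] standardize_less[of y w x] by simp
qed

text \<open>Border numbers depend only on comparisons of letters, which ranks preserve. This removes
  the standardizations in the recursion of \<open>dyck_path\<close>.\<close>

lemma left_borders_standardize: "left_borders (standardize w) = left_borders w"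
proof -
  have "left_border (standardize w) j = left_border w j" if "1 \<le> j" "j \<le> length w" for j
    using that by (intro left_border_cong) (simp add: letter_def standardize_def standardize_less)
  then show ?thesis by (auto simp: left_borders_def)
qed

text \<open>This mirrors the recursion of \<open>dyck_path\<close>. A letter of \<open>v\<close>
  with border 0 in \<open>v\<close> now has the position of \<open>m\<close>, namely
  \<open>Suc (length u)\<close>, as its border, so the same shift serves zero and positive
  borders.\<close>

lemma left_borders_split:
  assumes L: "\<And>x. x \<in> set u \<Longrightarrow> x < m" and R: "\<And>x. x \<in> set v \<Longrightarrow> x < m"
  shows "left_borders (u @ m # v) =
           left_borders u @ 0 # map ((+) (Suc (length u))) (left_borders v)"
proof (rule nth_equalityI)
  let ?w = "u @ m # v" and ?l = "length u"
  have lL: "letter ?w j = letter u j" if "1 \<le> j" "j \<le> ?l" for j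
    using that by (cases j) (simp_all add: letter_def nth_append)
  have lm: "letter ?w (Suc ?l) = m" by (simp add: letter_def)
  have lR: "letter ?w (Suc ?l + j) = letter v j" if "1 \<le> j" for j
    using that by (cases j) (simp_all add: letter_def nth_append)
  fix k assume "k < length (left_borders ?w)"
  then have k: "k < length ?w" by simp
  consider "k < ?l" | "k = ?l" | j where "k = Suc ?l + j" "j < length v"
  proof (cases k ?l rule: linorder_cases)
    case greater
    then show ?thesis using k that(3)[of "k - Suc ?l"] by simp
  qed (use that in auto)
  then show "left_borders ?w ! k =
      (left_borders u @ 0 # map ((+) (Suc ?l)) (left_borders v)) ! k"
  proof cases
    case 1
    have "left_border ?w (Suc k) = left_border u (Suc k)"
      by (rule left_border_cong) (use 1 in \<open>simp add: lL\<close>)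
    then show ?thesis using 1 by (simp add: nth_left_borders nth_append)
  next
    case 2
    have "left_border ?w (Suc ?l) = 0"
    proof (rule left_border_eq_0)
      fix i assume i: "1 \<le> i" "i < Suc ?l"
      then have "letter u i \<in> set u" by (simp add: letter_def)
      then show "letter ?w i \<le> letter ?w (Suc ?l)" using L i by (force simp: lL lm)
    qed
    then show ?thesis using 2 by (simp add: nth_left_borders nth_append)
  next
    case (3 j)
    have j: "letter ?w (Suc ?l + Suc j) = letter v (Suc j)" by (rule lR) simp
    have "letter v (Suc j) < m" using 3 by (simp add: letter_def R)
    have "left_border ?w (Suc ?l + Suc j) = Suc ?l + left_border v (Suc j)"
    proof (rule left_border_eqI)
      show "Suc ?l + left_border v (Suc j) < Suc ?l + Suc j"
        using left_border_less[of "Suc j" v] by simp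
      \<comment> \<open>If the border in \<open>v\<close> is the default 0, the position on the
        right is that of \<open>m\<close>; otherwise it lies in \<open>v\<close>.\<close>
      show "letter ?w (Suc ?l + Suc j) < letter ?w (Suc ?l + left_border v (Suc j))"
        using left_border_cases[of v "Suc j"] \<open>letter v (Suc j) < m\<close> lm j
          lR[of "left_border v (Suc j)"] by auto
    next
      fix i assume i: "Suc ?l + left_border v (Suc j) < i" "i < Suc ?l + Suc j"
      define i' where "i' = i - Suc ?l"
      have i': "i = Suc ?l + i'" "left_border v (Suc j) < i'" "i' < Suc j"
        using i by (auto simp: i'_def)
      then have "letter v i' \<le> letter v (Suc j)"
        using left_border_ge[of i' "Suc j" v] by force
      then show "letter ?w i \<le> letter ?w (Suc ?l + Suc j)"
        using i' j lR[of i'] by simp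
    qed simp
    then show ?thesis using 3 by (simp add: nth_left_borders nth_append)
  qed
qed simp

text \<open>Counterpart of \<open>dyck_path_split\<close> for all distinct words, the class over
  which the induction below runs.\<close>

lemma split_Max:
  assumes "distinct w" "w \<noteq> []"
  obtains u m v where "w = u @ m # v" "\<And>x. x \<in> set u \<union> set v \<Longrightarrow> x < m"
    "dyck_path w = U # dyck_path (standardize u) @ R # dyck_path (standardize v)"
proof -
  define m where "m = Max (set w)"
  define u where "u = takeWhile (\<lambda>x. x \<noteq> m) w"
  define v where "v = tl (dropWhile (\<lambda>x. x \<noteq> m) w)"
  have "m \<in> set w" using assms(2) by (simp add: m_def)
  then have ne: "dropWhile (\<lambda>x. x \<noteq> m) w \<noteq> []" by (auto simp: dropWhile_eq_Nil_conv)
  then have "hd (dropWhile (\<lambda>x. x \<noteq> m) w) = m"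
    using hd_dropWhile[of "\<lambda>x. x \<noteq> m" w] by simp
  then have "dropWhile (\<lambda>x. x \<noteq> m) w = m # v"
    using ne list.collapse[of "dropWhile (\<lambda>x. x \<noteq> m) w"] by (simp add: v_def)
  then have w: "w = u @ m # v"
    using takeWhile_dropWhile_id[of "\<lambda>x. x \<noteq> m" w] by (simp add: u_def)
  have "dyck_path w = U # dyck_path (standardize u) @ R # dyck_path (standardize v)"
    using assms(2) by (subst dyck_path.simps) (simp add: Let_def m_def u_def v_def)
  moreover have "x < m" if x: "x \<in> set u \<union> set v" for x
  proof -
    have "x \<in> set w" using x by (subst w) auto
    then have "x \<le> m" by (simp add: m_def)
    moreover have "distinct (u @ m # v)" using assms(1) by (subst (asm) w)
    then have "x \<noteq> m" using x by auto
    ultimately show ?thesis by simp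
  qed
  ultimately show ?thesis using that w by blast
qed

text \<open>The number of \<open>R\<close> steps is carried along because it provides the shift
  \<open>Suc (length u)\<close> for the right part, the same as in
  \<open>left_borders_split\<close>. Only multisets agree: the 0 of the split comes first in the
  path, but between the two parts in \<open>left_borders\<close>.\<close>

lemma right_counts_dyck_path:
  assumes "distinct w"
  shows "count_list (dyck_path w) R = length w \<and>
         mset (right_counts (dyck_path w)) = mset (left_borders w)"
  using assms
proof (induction "length w" arbitrary: w rule: less_induct)
  case less
  show ?case
  proof (cases "w = []")
    case False
    obtain u m v where w: "w = u @ m # v" and m: "\<And>x. x \<in> set u \<union> set v \<Longrightarrow> x < m"
      and path: "dyck_path w = U # dyck_path (standardize u) @ R # dyck_path (standardize v)"
      using split_Max[OF less.prems False] by blast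
    have d: "distinct (standardize u)" "distinct (standardize v)"
      using less.prems by (simp_all add: distinct_standardize w)
    have len: "length w = Suc (length u + length v)" by (simp add: w)
    have IH: "count_list (dyck_path (standardize u)) R = length u"
      "mset (right_counts (dyck_path (standardize u))) = mset (left_borders u)"
      "count_list (dyck_path (standardize v)) R = length v"
      "mset (right_counts (dyck_path (standardize v))) = mset (left_borders v)"
      using less.hyps[of "standardize u"] less.hyps[of "standardize v"] d len
      by (simp_all add: left_borders_standardize)
    have "left_borders w = left_borders u @ 0 # map ((+) (Suc (length u))) (left_borders v)"
      unfolding w by (rule left_borders_split) (use m in auto)
    moreover have "right_counts (dyck_path w) = 0 # right_counts (dyck_path (standardize u))
        @ map ((+) (Suc (length u))) (right_counts (dyck_path (standardize v)))"
      by (simp add: path right_counts_append IH o_def)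
    ultimately show ?thesis
      using IH by (simp add: path len)
  qed (simp add: dyck_path_Nil left_borders_def)
qed

text \<open>\<open>Lambda\<close> drops the count of the first up step, which is 0 since the path
  starts with \<open>U\<close>; \<open>add_mset 0\<close> restores it.\<close>

lemma mset_Lambda:
  assumes "distinct w" "w \<noteq> []"
  shows "add_mset 0 (mset (Lambda w)) = mset (left_borders w)"
proof -
  obtain p where "dyck_path w = U # p" using split_Max[OF assms] by blast
  then show ?thesis
    using right_counts_dyck_path[OF assms(1)] by (simp add: Lambda_eq)
qed

section \<open>Reading off the inversions\<close>

text \<open>The number of larger elements is an injective function from \<open>S\<close> to
  \<open>{..<card S}\<close>, hence onto. It serves to find a row with a prescribed number of
  equally long rows below it.\<close>

lemma exists_rank_from_above:
  fixes S :: "nat set"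
  assumes "finite S" "t < card S"
  shows "\<exists>r\<in>S. card {r' \<in> S. r < r'} = t"
proof -
  let ?f = "\<lambda>r. card {r' \<in> S. r < r'}"
  have less: "?f y < ?f x" if "x < y" "y \<in> S" for x y
  proof (rule psubset_card_mono)
    have "y \<in> {r' \<in> S. x < r'} - {r' \<in> S. y < r'}" using that by simp
    moreover have "{r' \<in> S. y < r'} \<subseteq> {r' \<in> S. x < r'}" using that by auto
    ultimately show "{r' \<in> S. y < r'} \<subset> {r' \<in> S. x < r'}" by blast
  qed (use assms(1) in simp)
  have "inj_on ?f S"
  proof (rule inj_onI)
    fix x y assume "x \<in> S" "y \<in> S" "?f x = ?f y"
    then show "x = y" using less[of x y] less[of y x] by (cases x y rule: linorder_cases) auto
  qed
  moreover have "?f ` S \<subseteq> {..<card S}"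
  proof clarsimp
    fix r assume "r \<in> S"
    then have "{r' \<in> S. r < r'} \<subset> S" by blast
    then show "?f r < card S" using assms(1) by (rule psubset_card_mono[rotated])
  qed
  ultimately have "?f ` S = {..<card S}"
    by (intro card_subset_eq) (auto simp: card_image)
  then have "t \<in> ?f ` S" using assms(2) by simp
  then show ?thesis by blast
qed

text \<open>There are as many rows of a positive length \<open>i\<close> as positions with border
  number \<open>i\<close>, so the index of \<open>j\<close> in the sorted list of these positions is
  the rank of some row.\<close>

lemma row_label_surj:
  assumes "distinct w" "1 \<le> j" "j \<le> length w" "0 < left_border w j"
  obtains r where "1 \<le> r" "r \<le> length (Lambda w)" "Lambda w ! (r - 1) = left_border w j"
    "row_label w r = j"
proof -
  define l i where "l = Lambda w" "i = left_border w j"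
  define J where "J = {j \<in> {1..length w}. left_border w j = i}"
  define S where "S = {r. 1 \<le> r \<and> r \<le> length l \<and> l ! (r - 1) = i}"
  have "S = Suc ` {k. k < length l \<and> l ! k = i}"
  proof (intro set_eqI iffI)
    fix r assume "r \<in> S"
    then show "r \<in> Suc ` {k. k < length l \<and> l ! k = i}"
      by (cases r) (auto simp: S_def)
  qed (auto simp: S_def)
  then have "card S = count (mset l) i"
    by (simp add: card_image count_mset count_list_eq_length_filter length_filter_conv_card eq_commute[of i])
  \<comment> \<open>Since \<open>i\<close> is positive, the additional 0 does not affect its
    count.\<close>
  also have "\<dots> = count (add_mset 0 (mset l)) i"
    using assms by (simp add: l_i_def)
  also have "add_mset 0 (mset l) = mset (left_borders w)"
    unfolding l_i_def using assms by (intro mset_Lambda) auto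
  also have "count (mset (left_borders w)) i = card J"
    by (simp add: count_left_borders J_def)
  finally have card: "card S = card J" .
  have "j \<in> set (sorted_list_of_set J)"
    using assms by (simp add: J_def l_i_def)
  then obtain t where t: "t < card J" "sorted_list_of_set J ! t = j"
    by (auto simp: in_set_conv_nth)
  have "finite S" by (simp add: S_def)
  then obtain r where r: "r \<in> S" "card {r' \<in> S. r < r'} = t"
    using exists_rank_from_above[of S t] t card by auto
  have "{r' \<in> S. r < r'} = {r'. r < r' \<and> r' \<le> length l \<and> l ! (r' - 1) = i}"
    by (auto simp: S_def)
  then have "row_label w r = j"
    using r t by (simp add: row_label_def Let_def S_def J_def l_i_def)
  then show ?thesis using r that by (auto simp: S_def l_i_def)
qed

text \<open>One implication is enough, as the assumptions are symmetric in \<open>v\<close> and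
  \<open>w\<close>.\<close>

lemma inversion_if_filled_shape_eq:
  assumes "distinct v" "distinct w" "length v = length w" "filled_shape v = filled_shape w"
    and inv: "inversion v i j"
  shows "inversion w i j"
proof -
  have ne: "v \<noteq> []" "w \<noteq> []" using inv assms(3) by (auto simp: inversion_def)
  have Lam: "Lambda v = Lambda w" and dots: "dotted_cells v = dotted_cells w"
    using assms(4) by (simp_all add: filled_shape_def)
  have "mset (left_borders v) = mset (left_borders w)"
    using mset_Lambda[OF assms(1) ne(1)] mset_Lambda[OF assms(2) ne(2)] unfolding Lam by (rule subst)
  then have "left_borders v = left_borders w" by (rule left_borders_eqI)
  then have lb: "left_border v k = left_border w k" if "1 \<le> k" "k \<le> length w" for k
    using that assms(3) nth_left_borders[of "k - 1" v] nth_left_borders[of "k - 1" w] by simp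
  have "{k \<in> {1..length v}. left_border v k = x} = {k \<in> {1..length w}. left_border w k = x}" for x
    by (rule Collect_cong) (use lb assms(3) in \<open>simp cong: conj_cong\<close>)
  \<comment> \<open>A row label is computed from the shape and the positions of each border number
    alone.\<close>
  then have lab: "row_label v r = row_label w r" for r
    unfolding row_label_def Lam Let_def by (simp only:)
  have ij: "1 \<le> i" "i < j" "j \<le> length v" "letter v i > letter v j"
    using inv by (auto simp: inversion_def)
  then have i: "i \<le> left_border v j" by (intro left_border_ge)
  have "1 \<le> j" "0 < left_border v j" using ij i by simp_all
  then obtain r where r: "1 \<le> r" "r \<le> length (Lambda v)"
    "Lambda v ! (r - 1) = left_border v j" "row_label v r = j"
    using assms(1) ij(3) row_label_surj by blast
  \<comment> \<open>Column \<open>i\<close> meets row \<open>r\<close> because \<open>i\<close> is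
    at most the row length \<open>left_border v j\<close>.\<close>
  then have "(r, i) \<in> dotted_cells v"
    using ij(1) i inv by (simp add: dotted_cells_def cells_def)
  then show ?thesis
    unfolding dots using r lab by (simp add: dotted_cells_def)
qed

text \<open>A letter of a permutation is one more than the number of positions with smaller letters,
  and the inversions decide every comparison between two positions.\<close>

lemma perms_eqI:
  assumes "v \<in> perms n" "w \<in> perms n" "\<And>i j. inversion v i j \<longleftrightarrow> inversion w i j"
  shows "v = w"
proof -
  have len: "length x = n" if "x \<in> perms n" for x
    using that by (metis card_atLeastAtMost diff_Suc_1 distinct_card permutations_of_setD)
  have nth: "x ! k = Suc (card {i. i < n \<and> x ! i < x ! k})" if x: "x \<in> perms n" and k: "k < n" for x k
  proof -
    have d: "distinct x" and s: "set x = {1..n}" using x permutations_of_setD by blast+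
    have "(!) x ` {i. i < n \<and> x ! i < x ! k} = {y \<in> set x. y < x ! k}"
      using len[OF x] by (auto simp: in_set_conv_nth image_iff)
    moreover have "{y \<in> set x. y < x ! k} = {1..<x ! k}"
      using s k len[OF x] nth_mem[of k x] by auto
    moreover have "inj_on ((!) x) {i. i < n \<and> x ! i < x ! k}"
      using d len[OF x] by (auto simp: inj_on_def nth_eq_iff_index_eq)
    ultimately have "card {i. i < n \<and> x ! i < x ! k} = x ! k - 1"
      using card_image[of "(!) x" "{i. i < n \<and> x ! i < x ! k}"] by simp
    moreover have "x ! k \<ge> 1" using s k len[OF x] nth_mem[of k x] by auto
    ultimately show ?thesis by simp
  qed
  \<comment> \<open>For \<open>i < k\<close>, distinct letters turn the absence of an inversion into
    a strict inequality. For \<open>i = k\<close> both sides are false. \<open>Suc\<close> passes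
    from list indices to positions.\<close>
  have less: "x ! i < x ! k \<longleftrightarrow>
      (if i < k then \<not> inversion x (Suc i) (Suc k) else inversion x (Suc k) (Suc i))"
    if "x \<in> perms n" "i < n" "k < n" for x i k
  proof -
    have "distinct x" using that permutations_of_setD by blast
    then have "x ! i = x ! k \<longleftrightarrow> i = k" using that len by (simp add: nth_eq_iff_index_eq)
    then show ?thesis using that len[of x] by (auto simp: inversion_def letter_def)
  qed
  have "v ! k = w ! k" if "k < n" for k
  proof -
    have "{i. i < n \<and> v ! i < v ! k} = {i. i < n \<and> w ! i < w ! k}"
      using less assms that by auto
    then show ?thesis using nth[OF assms(1) that] nth[OF assms(2) that] by simp
  qed
  then show ?thesis using len assms(1,2) by (auto intro: nth_equalityI)
qed

theorem mainTheorem8: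
  fixes n :: nat
  assumes "n \<ge> 1"
  shows "inj_on filled_shape (perms n)"
proof (rule inj_onI)
  fix v w assume vw: "v \<in> perms n" "w \<in> perms n" "filled_shape v = filled_shape w"
  have d: "distinct v" "distinct w" and len: "length v = length w"
    using permutations_of_setD[OF vw(1)] permutations_of_setD[OF vw(2)] distinct_card[of v] distinct_card[of w]
    by simp_all
  show "v = w"
  proof (rule perms_eqI[OF vw(1,2)])
    show "inversion v i j \<longleftrightarrow> inversion w i j" for i j
      using inversion_if_filled_shape_eq[OF d len vw(3)]
        inversion_if_filled_shape_eq[OF d(2,1) len[symmetric] vw(3)[symmetric]] by blast
  qed
qed

end
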